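(* Let $N\ge 3$ be an integer, $\beta\ge 0$, and let $X=(X_n)_{n\ge0}$ be the Gibbs sampler (defined in the context) for the Ising model on the circle with vertices $V=\{0,\ldots,N-1\}$ and edges $\{\{i,(i+1)\bmod N\}: i=0,\ldots,N-1\}$, with state space $\mathbb{E}=\{-1,1\}^V$, transition matrix $P$ and stationary distribution $\pi$. Assume that $X$ starts at the configuration $e_{1}$ with all spins equal to $-1$, i.e. its initial distribution is $\nu=\delta_{e_{1}}$. Then there exists a sharp strong stationary dual chain $X^*=(X^*_n)_{n\ge0}$ for $X$ on the state space $\mathbb{E}^*=\mathbb{E}$, with absorbing state $e_{M}$ (the configuration with all spins equal to $+1$), starting with probability $1$ at $e_{1}$, and having transition probabilities, for $e,e'\in\mathbb{E}$, $$P^*(e,e')=\begin{cases}0 & \text{if } e\succ e',\\[4pt] \dfrac{1}{N}\,S(e) & \text{if } e=e',\\[6pt] \dfrac{H(e')}{H(e)}\,\dfrac1N\left(1-\dfrac{e^{2\beta(k_+(j,e)-k_-(j,e))}}{e^{2\beta(k_+(j,e)-k_-(j,e))}+1}\right) & \text{if } e'=e+s_j \text{ for some } j\in V \text{ with } e(j)=-1,\end{cases}$$ where, inside the exponentials, the base $e$ is Euler's number. (These are the only pairs $(e,e')$ for which the value of $P^*(e,e')$ is specified.) Here $s_j$ is the vector with $2$ in coordinate $j$ and $0$ in all other coordinates, $S(e)=\sum_{i=0}^{N-1}\mathbf 1\{e(i)=1\}$, and $H(e)=\sum_{e'\preceq e}\pi(e')$.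
   Context: Gibbs sampler. Vertex numbers are taken modulo $N$. For a configuration $e\in\mathbb{E}=\{-1,1\}^V$ and a vertex $i$, $k_+(i,e)$ (resp. $k_-(i,e)$) is the number of neighbours of $i$ (i.e. among $i-1,i+1$ mod $N$) whose spin in $e$ is $+1$ (resp. $-1$). From configuration $e$, one step of $X$ is: choose a vertex $i\in V$ uniformly at random (probability $1/N$ each); then, independently of everything else, set the spin at $i$ to $+1$ with probability $\dfrac{\exp(2\beta(k_+(i,e)-k_-(i,e)))}{\exp(2\beta(k_+(i,e)-k_-(i,e)))+1}$ and to $-1$ otherwise; all other spins are unchanged. Its stationary distribution is $\pi(e)=\frac{1}{Z_\beta}\exp\left(\beta\sum_{i=0}^{N-1}e(i)e(i+1)\right)$ with $Z_\beta$ the normalizing constant. Ordering. $\preceq$ is the coordinate-wise partial order on $\mathbb{E}$: $e\preceq e'$ iff $e(i)\le e'(i)$ for all $i\in V$; $e\succ e'$ means $e'\preceq e$ and $e\ne e'$. The minimal state is $e_1$ (all $-1$) and the maximal state is $e_M$ (all $+1$), where $M=2^N$. Strong stationary duality. Let $X$ be an ergodic Markov chain on a finite set $\mathbb{E}$ with transition matrix $P$, initial distribution $\nu$ and stationary distribution $\pi$. A Markov chain $X^*$ with state space $\mathbb{E}^*$, transition matrix $P^*$, initial distribution $\nu^*$ and an absorbing state $e_a^*$ is a strong stationary dual (SSD) chain for $X$ if there is a stochastic kernel (link) $\Lambda(e^*,e)$, $e^*\in\mathbb{E}^*$, $e\in\mathbb{E}$, with $\Lambda(e_a^*,\cdot)=\pi$,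 $\nu=\nu^*\Lambda$ and $\Lambda P=P^*\Lambda$. With $T^*$ the absorption time of $X^*$ in $e_a^*$, and separation distance $s(\nu P^n,\pi)=\max_{e\in\mathbb{E}}\left(1-\nu P^n(e)/\pi(e)\right)$, the SSD chain is called sharp if $s(\nu P^n,\pi)=P(T^*>n)$ for all $n\ge0$. *)

theory Defs
  imports "HOL-Probability.Probability"
begin

section \<open>Finite Markov chains and strong stationary duality\<close>

text \<open>Distributions and matrices are real-valued functions on a finite index set \<open>E\<close>;
  their values outside \<open>E\<close> are irrelevant.\<close>

definition distribution_on :: "'s set \<Rightarrow> ('s \<Rightarrow> real) \<Rightarrow> bool" where
  "distribution_on E \<mu> \<longleftrightarrow> (\<forall>x\<in>E. 0 \<le> \<mu> x) \<and> (\<Sum>x\<in>E. \<mu> x) = 1"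

definition stochastic_kernel :: "'a set \<Rightarrow> 'b set \<Rightarrow> ('a \<Rightarrow> 'b \<Rightarrow> real) \<Rightarrow> bool" where
  "stochastic_kernel A B K \<longleftrightarrow> (\<forall>x\<in>A. distribution_on B (K x))"

definition vec_mat :: "'a set \<Rightarrow> ('a \<Rightarrow> real) \<Rightarrow> ('a \<Rightarrow> 'b \<Rightarrow> real) \<Rightarrow> 'b \<Rightarrow> real" where
  "vec_mat E \<mu> K y = (\<Sum>x\<in>E. \<mu> x * K x y)"

definition mat_prod ::
  "'b set \<Rightarrow> ('a \<Rightarrow> 'b \<Rightarrow> real) \<Rightarrow> ('b \<Rightarrow> 'c \<Rightarrow> real) \<Rightarrow> 'a \<Rightarrow> 'c \<Rightarrow> real" where
  "mat_prod E K L x y = (\<Sum>z\<in>E. K x z * L z y)"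

primrec mat_pow :: "'s set \<Rightarrow> ('s \<Rightarrow> 's \<Rightarrow> real) \<Rightarrow> nat \<Rightarrow> 's \<Rightarrow> 's \<Rightarrow> real" where
  "mat_pow E P 0 = (\<lambda>x y. if x = y then 1 else 0)"
| "mat_pow E P (Suc n) = mat_prod E (mat_pow E P n) P"

definition point_mass :: "'s \<Rightarrow> 's \<Rightarrow> real" where
  "point_mass a x = (if x = a then 1 else 0)"

definition irreducible_on :: "'s set \<Rightarrow> ('s \<Rightarrow> 's \<Rightarrow> real) \<Rightarrow> bool" where
  "irreducible_on E P \<longleftrightarrow> (\<forall>x\<in>E. \<forall>y\<in>E. \<exists>n. mat_pow E P n x y > 0)"

definition aperiodic_on :: "'s set \<Rightarrow> ('s \<Rightarrow> 's \<Rightarrow> real) \<Rightarrow> bool" where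
  "aperiodic_on E P \<longleftrightarrow> (\<forall>x\<in>E. Gcd {n. n \<ge> 1 \<and> mat_pow E P n x x > 0} = 1)"

definition ergodic_on :: "'s set \<Rightarrow> ('s \<Rightarrow> 's \<Rightarrow> real) \<Rightarrow> bool" where
  "ergodic_on E P \<longleftrightarrow> irreducible_on E P \<and> aperiodic_on E P"

definition stationary_distribution :: "'s set \<Rightarrow> ('s \<Rightarrow> 's \<Rightarrow> real) \<Rightarrow> ('s \<Rightarrow> real) \<Rightarrow> bool" where
  "stationary_distribution E P \<pi> \<longleftrightarrow>
     distribution_on E \<pi> \<and> (\<forall>y\<in>E. vec_mat E \<pi> P y = \<pi> y)"

locale markov_chain = prob_space M
  for M :: "'w measure" +
  fixes X :: "nat \<Rightarrow> 'w \<Rightarrow> 's"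
    and E :: "'s set"
    and P :: "'s \<Rightarrow> 's \<Rightarrow> real"
    and \<nu> :: "'s \<Rightarrow> real"
  assumes finite_states: "finite E"
    and stochastic: "stochastic_kernel E E P"
    and initial: "distribution_on E \<nu>"
    and measurable_X: "\<And>n. X n \<in> measurable M (count_space E)"
    and initial_law: "\<And>x. x \<in> E \<Longrightarrow> \<P>(\<omega> in M. X 0 \<omega> = x) = \<nu> x"
    and markov_property: "\<And>n x y. \<lbrakk>\<forall>k\<le>n. x k \<in> E; y \<in> E;
          \<P>(\<omega> in M. \<forall>k\<le>n. X k \<omega> = x k) > 0\<rbrakk> \<Longrightarrow>
        \<P>(\<omega> in M. X (Suc n) \<omega> = y \<bar> \<forall>k\<le>n. X k \<omega> = x k) = P (x n) y"

text \<open>The infimum of the empty set is \<open>\<infinity>\<close>.\<close>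

definition absorption_time :: "(nat \<Rightarrow> 'w \<Rightarrow> 's) \<Rightarrow> 's \<Rightarrow> 'w \<Rightarrow> enat" where
  "absorption_time X a \<omega> = (INF n\<in>{n. X n \<omega> = a}. enat n)"

definition separation :: "'s set \<Rightarrow> ('s \<Rightarrow> real) \<Rightarrow> ('s \<Rightarrow> real) \<Rightarrow> real" where
  "separation E \<mu> \<pi> = Max ((\<lambda>x. 1 - \<mu> x / \<pi> x) ` E)"

text \<open>\<open>(M', X')\<close> is a Markov chain on \<open>E'\<close> with transition matrix \<open>P'\<close>, initial distribution
  \<open>\<nu>'\<close> and absorbing state \<open>a\<close>; it is a strong stationary dual of the ergodic chain \<open>(M, X)\<close>.\<close>

definition strong_stationary_dual ::
  "'w measure \<Rightarrow> (nat \<Rightarrow> 'w \<Rightarrow> 's) \<Rightarrow> 's set \<Rightarrow> ('s \<Rightarrow> 's \<Rightarrow> real) \<Rightarrow> ('s \<Rightarrow> real) \<Rightarrow> ('s \<Rightarrow> real) \<Rightarrow>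
   'v measure \<Rightarrow> (nat \<Rightarrow> 'v \<Rightarrow> 't) \<Rightarrow> 't set \<Rightarrow> ('t \<Rightarrow> 't \<Rightarrow> real) \<Rightarrow> ('t \<Rightarrow> real) \<Rightarrow> 't \<Rightarrow> bool" where
  "strong_stationary_dual M X E P \<nu> \<pi> M' X' E' P' \<nu>' a \<longleftrightarrow>
     markov_chain M X E P \<nu> \<and> ergodic_on E P \<and> stationary_distribution E P \<pi> \<and>
     markov_chain M' X' E' P' \<nu>' \<and> a \<in> E' \<and> P' a a = 1 \<and>
     (\<exists>\<Lambda>. stochastic_kernel E' E \<Lambda> \<and>
          (\<forall>x\<in>E. \<Lambda> a x = \<pi> x) \<and>
          (\<forall>x\<in>E. \<nu> x = vec_mat E' \<nu>' \<Lambda> x) \<and>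
          (\<forall>y\<in>E'. \<forall>x\<in>E. mat_prod E \<Lambda> P y x = mat_prod E' P' \<Lambda> y x))"

definition sharp_strong_stationary_dual ::
  "'w measure \<Rightarrow> (nat \<Rightarrow> 'w \<Rightarrow> 's) \<Rightarrow> 's set \<Rightarrow> ('s \<Rightarrow> 's \<Rightarrow> real) \<Rightarrow> ('s \<Rightarrow> real) \<Rightarrow> ('s \<Rightarrow> real) \<Rightarrow>
   'v measure \<Rightarrow> (nat \<Rightarrow> 'v \<Rightarrow> 't) \<Rightarrow> 't set \<Rightarrow> ('t \<Rightarrow> 't \<Rightarrow> real) \<Rightarrow> ('t \<Rightarrow> real) \<Rightarrow> 't \<Rightarrow> bool" where
  "sharp_strong_stationary_dual M X E P \<nu> \<pi> M' X' E' P' \<nu>' a \<longleftrightarrow>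
     strong_stationary_dual M X E P \<nu> \<pi> M' X' E' P' \<nu>' a \<and>
     (\<forall>n. separation E (vec_mat E \<nu> (mat_pow E P n)) \<pi> =
          \<P>(\<omega> in M'. absorption_time X' a \<omega> > enat n))"

section \<open>The Ising model on the circle and its Gibbs sampler\<close>

text \<open>Configurations are extensional functions, i.e. equal to \<open>undefined\<close> outside the vertex set
  \<open>{..<N}\<close>, so that equality of functions is equality of configurations.\<close>

type_synonym config = "nat \<Rightarrow> int"

definition configs :: "nat \<Rightarrow> config set" where
  "configs N = ({..<N} \<rightarrow>\<^sub>E {-1, 1})"

definition all_minus :: "nat \<Rightarrow> config" where
  "all_minus N = (\<lambda>i\<in>{..<N}. -1)"

definition all_plus :: "nat \<Rightarrow> config" where
  "all_plus N = (\<lambda>i\<in>{..<N}. 1)"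

definition config_le :: "nat \<Rightarrow> config \<Rightarrow> config \<Rightarrow> bool" where
  "config_le N e e' \<longleftrightarrow> (\<forall>i<N. e i \<le> e' i)"

definition config_less :: "nat \<Rightarrow> config \<Rightarrow> config \<Rightarrow> bool" where
  "config_less N e e' \<longleftrightarrow> config_le N e e' \<and> e \<noteq> e'"

definition circle_edges :: "nat \<Rightarrow> nat set set" where
  "circle_edges N = (\<lambda>i. {i, (i + 1) mod N}) ` {..<N}"

definition neighbours :: "nat \<Rightarrow> nat \<Rightarrow> nat set" where
  "neighbours N i = {j. {i, j} \<in> circle_edges N}"

definition k_plus :: "nat \<Rightarrow> nat \<Rightarrow> config \<Rightarrow> nat" where
  "k_plus N i e = card {j \<in> neighbours N i. e j = 1}"

definition k_minus :: "nat \<Rightarrow> nat \<Rightarrow> config \<Rightarrow> nat" where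
  "k_minus N i e = card {j \<in> neighbours N i. e j = -1}"

definition up_prob :: "nat \<Rightarrow> real \<Rightarrow> nat \<Rightarrow> config \<Rightarrow> real" where
  "up_prob N \<beta> i e =
     exp (2 * \<beta> * (real (k_plus N i e) - real (k_minus N i e))) /
     (exp (2 * \<beta> * (real (k_plus N i e) - real (k_minus N i e))) + 1)"

definition gibbs_step :: "nat \<Rightarrow> real \<Rightarrow> config \<Rightarrow> config pmf" where
  "gibbs_step N \<beta> e =
     bind_pmf (pmf_of_set {..<N}) (\<lambda>i.
       map_pmf (\<lambda>up. e(i := if up then 1 else -1)) (bernoulli_pmf (up_prob N \<beta> i e)))"

definition gibbs_matrix :: "nat \<Rightarrow> real \<Rightarrow> config \<Rightarrow> config \<Rightarrow> real" where
  "gibbs_matrix N \<beta> e e' = pmf (gibbs_step N \<beta> e) e'"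

definition ising_weight :: "nat \<Rightarrow> real \<Rightarrow> config \<Rightarrow> real" where
  "ising_weight N \<beta> e = exp (\<beta> * (\<Sum>i<N. real_of_int (e i * e ((i + 1) mod N))))"

definition ising_dist :: "nat \<Rightarrow> real \<Rightarrow> config \<Rightarrow> real" where
  "ising_dist N \<beta> e = ising_weight N \<beta> e / (\<Sum>e'\<in>configs N. ising_weight N \<beta> e')"

definition num_plus :: "nat \<Rightarrow> config \<Rightarrow> nat" where
  "num_plus N e = card {i. i < N \<and> e i = 1}"

definition down_mass :: "nat \<Rightarrow> real \<Rightarrow> config \<Rightarrow> real" where
  "down_mass N \<beta> e = (\<Sum>e' | e' \<in> configs N \<and> config_le N e' e. ising_dist N \<beta> e')"

end

theory Submission
  imports Defs
begin

text \<open>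
  The Gibbs sampler is reversible, so the natural dual is the one with link
  \<open>\<Lambda>(e, \<cdot>) = \<pi>\<close> conditioned on the down-set \<open>{x. x \<preceq> e}\<close>. With \<open>H e = \<pi>{x. x \<preceq> e}\<close> and
  \<open>P'(e, e') = H e' / H e * Q(e, e')\<close>, reversibility turns the intertwining \<open>\<Lambda> P = P' \<Lambda>\<close> into
  \<^item> \<open>(\<Sum>e' \<succeq> x. Q(e, e')) = P(x, {y. y \<preceq> e})\<close> for all \<open>x\<close> and \<open>e\<close>,

  that is, \<open>Q(e, \<cdot>)\<close> is the Moebius inverse of \<open>x \<mapsto> P(x, {y. y \<preceq> e})\<close>, and the only question is
  whether it is nonnegative (\<open>down_link_intertwines\<close>).

  On the circle it is. The right-hand side splits over the updated site \<open>j\<close>. If \<open>e j = 1\<close>, the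
  update cannot leave the down-set, and the site contributes the indicator of \<open>x \<preceq> e\<close>. If
  \<open>e j = -1\<close>, the site contributes the probability that \<open>j\<close> is set to \<open>-1\<close>, on the event that
  \<open>x\<close> lies below \<open>e\<close> with \<open>j\<close> raised. This probability takes three values, for neighbour sums
  \<open>-2\<close>, \<open>0\<close>, \<open>2\<close>; by spin-flip symmetry the outer two add up to \<open>1\<close> and the middle one is
  \<open>1/2\<close>, so it is an affine and (as \<open>\<beta> \<ge> 0\<close>) decreasing function of the neighbour sum
  (\<open>down_prob_affine\<close>). Being affine, it has no mixed second difference in the two neighbours, hence
  the Moebius inverse only charges \<open>e\<close> with \<open>j\<close> raised, and \<open>e\<close> with \<open>j\<close> raised and one
  \<open>+1\<close> neighbour lowered; being decreasing, it makes all these masses nonnegative. This is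
  \<open>dual_weight\<close>, with \<open>dual_weight_moebius\<close>.

  Row sums of \<open>P'\<close> come from the intertwining. Sharpness follows because \<open>all_plus\<close> lies only
  in its own down-set: \<open>\<Lambda>(e, all_plus) = 0\<close> for \<open>e \<noteq> all_plus\<close>, so the ratio of the law of \<open>X\<close> to
  \<open>\<pi>\<close> is smallest at \<open>all_plus\<close>, where it equals the absorbed mass of the dual
  (\<open>separation_eq_unabsorbed_mass\<close>). A process realising \<open>P'\<close> is built from independent random
  instructions, one for each time and state (\<open>markov_chain_exists\<close>).
\<close>

section \<open>Iterated kernels\<close>

lemma vec_mat_assoc:
  "vec_mat F (vec_mat E \<mu> K) L y = vec_mat E \<mu> (mat_prod F K L) y"
proof -
  have "(\<Sum>z\<in>F. (\<Sum>x\<in>E. \<mu> x * K x z) * L z y) = (\<Sum>z\<in>F. \<Sum>x\<in>E. \<mu> x * (K x z * L z y))"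
    by (simp add: sum_distrib_right mult.assoc)
  also have "\<dots> = (\<Sum>x\<in>E. \<mu> x * (\<Sum>z\<in>F. K x z * L z y))"
    by (subst sum.swap) (simp add: sum_distrib_left)
  finally show ?thesis by (simp add: vec_mat_def mat_prod_def)
qed

lemma vec_mat_cong:
  "(\<And>x. x \<in> E \<Longrightarrow> \<mu> x = \<mu>' x) \<Longrightarrow> (\<And>x. x \<in> E \<Longrightarrow> K x y = K' x y) \<Longrightarrow>
    vec_mat E \<mu> K y = vec_mat E \<mu>' K' y"
  by (simp add: vec_mat_def)

lemma vec_mat_pow_0:
  "finite E \<Longrightarrow> y \<in> E \<Longrightarrow> vec_mat E \<mu> (mat_pow E P 0) y = \<mu> y"
  by (simp add: vec_mat_def if_distrib cong: if_cong)

lemma vec_mat_pow_Suc: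
  "vec_mat E \<mu> (mat_pow E P (Suc n)) y = vec_mat E (vec_mat E \<mu> (mat_pow E P n)) P y"
  by (simp add: vec_mat_assoc)

lemma vec_mat_pow_nonneg:
  assumes "finite E" "stochastic_kernel E E P" "distribution_on E \<mu>" "y \<in> E"
  shows "vec_mat E \<mu> (mat_pow E P n) y \<ge> 0"
  using assms(4)
proof (induction n arbitrary: y)
  case 0
  then show ?case
    using assms by (simp add: vec_mat_pow_0 distribution_on_def del: mat_pow.simps)
next
  case (Suc n)
  show ?case
    unfolding vec_mat_pow_Suc vec_mat_def[where K = P]
    using Suc assms(2) by (intro sum_nonneg mult_nonneg_nonneg)
      (auto simp: stochastic_kernel_def distribution_on_def)
qed

lemma mat_pow_nonneg:
  assumes "stochastic_kernel E E P" "x \<in> E" "y \<in> E"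
  shows "mat_pow E P n x y \<ge> 0"
  using assms(3)
proof (induction n arbitrary: y)
  case (Suc n)
  show ?case
    unfolding mat_pow.simps mat_prod_def using Suc assms(1)
    by (intro sum_nonneg mult_nonneg_nonneg) (auto simp: stochastic_kernel_def distribution_on_def)
qed simp

section \<open>Existence of Markov chains\<close>

text \<open>The noise \<open>\<omega> (n, x)\<close> is the instruction where to go when the chain is in state \<open>x\<close> at
  time \<open>n\<close>.\<close>

primrec trajectory :: "'s \<Rightarrow> (nat \<times> 's \<Rightarrow> 's) \<Rightarrow> nat \<Rightarrow> 's" where
  "trajectory s \<omega> 0 = s"
| "trajectory s \<omega> (Suc n) = \<omega> (n, trajectory s \<omega> n)"

lemma prob_space_point_measure_distribution:
  assumes "finite E" "distribution_on E \<mu>"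
  shows "prob_space (point_measure E (\<lambda>y. ennreal (\<mu> y)))"
proof (rule prob_spaceI)
  have "(\<Sum>y\<in>E. ennreal (\<mu> y)) = ennreal (\<Sum>y\<in>E. \<mu> y)"
    using assms(2) by (intro sum_ennreal) (auto simp: distribution_on_def)
  then show "emeasure (point_measure E (\<lambda>y. ennreal (\<mu> y)))
      (space (point_measure E (\<lambda>y. ennreal (\<mu> y)))) = 1"
    using assms by (simp add: space_point_measure emeasure_point_measure_finite distribution_on_def)
qed

text \<open>If the instructions are independent and \<open>\<omega> (n, x)\<close> has law \<open>P x\<close>, then a trajectory follows a
  given path exactly when finitely many distinct instructions take prescribed values, so path
  probabilities are products of transition probabilities. The law of the trajectory is a measure on
  path space, under which the coordinate process is the required chain.\<close>

lemma markov_chain_exists: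
  fixes P :: "'s \<Rightarrow> 's \<Rightarrow> real"
  assumes fin: "finite E" and stoch: "stochastic_kernel E E P" and s: "s \<in> E"
  shows "\<exists>M' :: (nat \<Rightarrow> 's) measure. markov_chain M' (\<lambda>n \<omega>. \<omega> n) E P (point_mass s)"
proof -
  \<comment> \<open>Instructions for \<open>x \<notin> E\<close> are never read; the law \<open>P s\<close> keeps them \<open>E\<close>-valued.\<close>
  define row where "row x = point_measure E (\<lambda>y. ennreal (P (if x \<in> E then x else s) y))" for x
  have dist: "distribution_on E (P x)" if "x \<in> E" for x
    using stoch that by (simp add: stochastic_kernel_def)
  have prob_row: "prob_space (row x)" for x
    unfolding row_def using s by (intro prob_space_point_measure_distribution fin dist) auto
  have space_row: "space (row x) = E" and sets_row: "sets (row x) = Pow E" for x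
    by (simp_all add: row_def space_point_measure sets_point_measure)
  have row_single: "measure (row x) {y} = P x y" if "x \<in> E" "y \<in> E" for x y
    using that dist[OF that(1)] fin
    by (simp add: row_def measure_def emeasure_point_measure_finite distribution_on_def)
  define M0 where "M0 = PiM (UNIV :: (nat \<times> 's) set) (\<lambda>i. row (snd i))"
  interpret prod: product_prob_space "\<lambda>i. row (snd i)" "UNIV :: (nat \<times> 's) set"
    by (intro product_prob_spaceI prob_row)
  have prob_M0: "prob_space M0"
    unfolding M0_def by (rule prob_space_PiM) (rule prob_row)
  have space_M0: "space M0 = {\<omega>. \<forall>i. \<omega> i \<in> E}"
    by (auto simp: M0_def space_PiM space_row)
  have traj_E: "trajectory s \<omega> n \<in> E" if "\<omega> \<in> space M0" for \<omega> n
    using that s by (induction n) (auto simp: space_M0)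
  have coord: "(\<lambda>\<omega>. \<omega> i) \<in> measurable M0 (count_space E)" for i
  proof -
    have "(\<lambda>\<omega>. \<omega> i) \<in> measurable M0 (row (snd i))"
      unfolding M0_def by measurable
    moreover have "sets (row (snd i)) = sets (count_space E)"
      by (simp add: sets_row)
    ultimately show ?thesis
      using measurable_cong_sets by blast
  qed
  have traj_meas: "(\<lambda>\<omega>. trajectory s \<omega> n) \<in> measurable M0 (count_space E)" for n
  proof (induction n)
    case 0
    then show ?case using s by simp
  next
    case (Suc n)
    show ?case
      unfolding trajectory.simps
      by (rule measurable_compose_countable'[OF coord Suc countable_finite[OF fin]])
  qed
  have path_prob: "measure M0 {\<omega> \<in> space M0. \<forall>k\<le>n. trajectory s \<omega> k = x k}
      = (if x 0 = s then \<Prod>k<n. P (x k) (x (Suc k)) else 0)" if xE: "\<forall>k\<le>n. x k \<in> E" for n x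
  proof (cases "x 0 = s")
    case False
    then have "{\<omega> \<in> space M0. \<forall>k\<le>n. trajectory s \<omega> k = x k} = {}"
      by force
    then show ?thesis using False by (simp only: measure_empty if_False)
  next
    case True
    \<comment> \<open>The instructions that the path \<open>x\<close> reads; they are distinct because their times are.\<close>
    define J where "J = (\<lambda>k. (k, x k)) ` {..<n}"
    have iff: "(\<forall>k\<le>m. trajectory s \<omega> k = x k) \<longleftrightarrow> (\<forall>k<m. \<omega> (k, x k) = x (Suc k))" for m \<omega>
    proof (induction m)
      case 0
      then show ?case using True by simp
    next
      case (Suc m)
      have "(\<forall>k\<le>Suc m. trajectory s \<omega> k = x k) \<longleftrightarrow>
          (\<forall>k\<le>m. trajectory s \<omega> k = x k) \<and> trajectory s \<omega> (Suc m) = x (Suc m)"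
        by (auto simp: le_Suc_eq simp del: trajectory.simps)
      also have "\<dots> \<longleftrightarrow> (\<forall>k\<le>m. trajectory s \<omega> k = x k) \<and> \<omega> (m, x m) = x (Suc m)"
        by auto
      finally show ?case unfolding Suc
        by (auto simp: less_Suc_eq)
    qed
    have "{\<omega> \<in> space M0. \<forall>k\<le>n. trajectory s \<omega> k = x k} =
        prod.emb UNIV J (PiE J (\<lambda>i. {x (Suc (fst i))}))"
      unfolding iff
      by (auto simp: prod_emb_def M0_def space_PiM J_def space_row PiE_iff)
    also have "measure M0 \<dots> = (\<Prod>i\<in>J. measure (row (snd i)) {x (Suc (fst i))})"
      unfolding M0_def
      by (rule prod.measure_PiM_emb) (auto simp: J_def sets_row xE)
    also have "\<dots> = (\<Prod>k<n. P (x k) (x (Suc k)))"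
      unfolding J_def by (subst prod.reindex) (auto simp: inj_on_def row_single xE)
    finally show ?thesis using True by simp
  qed
  define M1 where "M1 = distr M0 (PiM UNIV (\<lambda>_. count_space E)) (trajectory s)"
  have meas: "trajectory s \<in> measurable M0 (PiM UNIV (\<lambda>_. count_space E))"
  proof (rule measurable_PiM_single')
    show "(\<lambda>\<omega>. trajectory s \<omega> i) \<in> measurable M0 (count_space E)" for i
      by (rule traj_meas)
  qed (auto simp: traj_E)
  have coord1: "(\<lambda>\<omega>. \<omega> n) \<in> measurable M1 (count_space E)" for n
    unfolding M1_def by (simp cong: measurable_cong_sets)
  have path1: "measure M1 {\<omega> \<in> space M1. \<forall>k\<le>n. \<omega> k = x k}
      = (if x 0 = s then \<Prod>k<n. P (x k) (x (Suc k)) else 0)" if xE: "\<forall>k\<le>n. x k \<in> E" for n x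
  proof -
    have "{\<omega> \<in> space M1. \<forall>k\<le>n. \<omega> k = x k} \<in> sets M1"
    proof -
      have "{\<omega> \<in> space M1. \<omega> k = x k} \<in> sets M1" if "k \<le> n" for k
        using measurable_sets[OF coord1, of "{x k}" k] xE that
        by (simp add: vimage_def Int_def conj_commute)
      then show ?thesis
        using sets.sets_Collect_finite_All'[of "{..n}" M1 "\<lambda>k \<omega>. \<omega> k = x k"] by auto
    qed
    then have "measure M1 {\<omega> \<in> space M1. \<forall>k\<le>n. \<omega> k = x k} =
        measure M0 (trajectory s -` {\<omega> \<in> space M1. \<forall>k\<le>n. \<omega> k = x k} \<inter> space M0)"
      unfolding M1_def by (intro measure_distr[OF meas]) simp
    also have "trajectory s -` {\<omega> \<in> space M1. \<forall>k\<le>n. \<omega> k = x k} \<inter> space M0 =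
        {\<omega> \<in> space M0. \<forall>k\<le>n. trajectory s \<omega> k = x k}"
      by (auto simp: M1_def space_PiM traj_E)
    finally show ?thesis by (simp only: path_prob[OF xE])
  qed
  have "markov_chain M1 (\<lambda>n \<omega>. \<omega> n) E P (point_mass s)"
  proof (intro markov_chain.intro markov_chain_axioms.intro)
    show "prob_space M1"
      unfolding M1_def by (rule prob_space.prob_space_distr[OF prob_M0 meas])
    show "distribution_on E (point_mass s)"
      using fin s by (simp add: distribution_on_def point_mass_def)
    show "(\<lambda>\<omega>. \<omega> n) \<in> measurable M1 (count_space E)" for n by (rule coord1)
    show "measure M1 {\<omega> \<in> space M1. \<omega> 0 = x} = point_mass s x" if "x \<in> E" for x
      using path1[of 0 "\<lambda>_. x"] that by (simp add: point_mass_def)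
    show "cond_prob M1 (\<lambda>\<omega>. \<omega> (Suc n) = y) (\<lambda>\<omega>. \<forall>k\<le>n. \<omega> k = x k) = P (x n) y"
      if x: "\<forall>k\<le>n. x k \<in> E" and y: "y \<in> E"
        and pos: "measure M1 {\<omega> \<in> space M1. \<forall>k\<le>n. \<omega> k = x k} > 0" for n x y
    proof -
      let ?x = "x(Suc n := y)"
      have "{\<omega> \<in> space M1. \<omega> (Suc n) = y \<and> (\<forall>k\<le>n. \<omega> k = x k)} =
          {\<omega> \<in> space M1. \<forall>k\<le>Suc n. \<omega> k = ?x k}"
        by (auto simp: le_Suc_eq)
      moreover have "measure M1 {\<omega> \<in> space M1. \<forall>k\<le>Suc n. \<omega> k = ?x k} =
          measure M1 {\<omega> \<in> space M1. \<forall>k\<le>n. \<omega> k = x k} * P (x n) y"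
        using x y by (subst (1 2) path1) auto
      ultimately show ?thesis
        using pos by (simp add: cond_prob_def)
    qed
  qed (use fin stoch in auto)
  then show ?thesis by blast
qed

section \<open>Marginal laws and absorption\<close>

context markov_chain
begin

lemma state_event [measurable]: "{\<omega> \<in> space M. X n \<omega> = y} \<in> events"
proof (cases "y \<in> E")
  case True
  then have "X n -` {y} \<inter> space M \<in> events"
    by (intro measurable_sets[OF measurable_X]) auto
  then show ?thesis by (simp add: vimage_def Int_def conj_commute)
next
  case False
  then have "{\<omega> \<in> space M. X n \<omega> = y} = {}"
    using measurable_space[OF measurable_X[of n]] by auto
  then show ?thesis by (simp only: sets.empty_sets)
qed

lemma state_in: "\<omega> \<in> space M \<Longrightarrow> X n \<omega> \<in> E"
  using measurable_space[OF measurable_X[of n]] by simp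

text \<open>The Markov property conditions on whole paths; summing over all paths that end in \<open>x\<close> at
  time \<open>n\<close> gives the two-time law.\<close>

lemma transition_law:
  assumes x: "x \<in> E" and y: "y \<in> E"
  shows "\<P>(\<omega> in M. X n \<omega> = x \<and> X (Suc n) \<omega> = y) = \<P>(\<omega> in M. X n \<omega> = x) * P x y"
proof -
  define W where "W = {w \<in> {..n} \<rightarrow>\<^sub>E E. w n = x}"
  define path where "path w = {\<omega> \<in> space M. \<forall>k\<le>n. X k \<omega> = w k}" for w
  define next_y where "next_y = {\<omega> \<in> space M. X (Suc n) \<omega> = y}"
  have fin: "finite W"
    unfolding W_def by (intro finite_subset[OF _ finite_PiE[of "{..n}" "\<lambda>_. E"]] finite_states) auto
  have path_ev: "path w \<in> events" for w
    using sets.sets_Collect_finite_All'[of "{..n}" M "\<lambda>k \<omega>. X k \<omega> = w k"] state_event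
    by (auto simp: path_def)
  have next_ev: "next_y \<in> events"
    unfolding next_y_def by (rule state_event)
  have disj: "disjoint_family_on path W"
  proof (unfold disjoint_family_on_def, intro ballI impI)
    fix v w assume v: "v \<in> W" and w: "w \<in> W" and ne: "v \<noteq> w"
    have "v \<in> {..n} \<rightarrow>\<^sub>E E" "w \<in> {..n} \<rightarrow>\<^sub>E E"
      using v w by (auto simp: W_def)
    then have "\<exists>k\<in>{..n}. v k \<noteq> w k"
      using ne PiE_ext[of v "{..n}" "\<lambda>_. E" w] by blast
    then obtain k where "k \<le> n" "v k \<noteq> w k" by auto
    then show "path v \<inter> path w = {}" by (force simp: path_def)
  qed
  have cover: "\<exists>w\<in>W. \<omega> \<in> path w" if "\<omega> \<in> space M" "X n \<omega> = x" for \<omega>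
    using that by (intro bexI[of _ "restrict (\<lambda>k. X k \<omega>) {..n}"]) (auto simp: W_def path_def state_in)
  have "path w \<subseteq> {\<omega> \<in> space M. X n \<omega> = x}" if "w \<in> W" for w
    using that by (auto simp: W_def path_def)
  then have union: "{\<omega> \<in> space M. X n \<omega> = x} = (\<Union>w\<in>W. path w)"
    using cover by blast
  have step: "prob (path w \<inter> next_y) = prob (path w) * P x y" if "w \<in> W" for w
  \<comment> \<open>The Markov property says nothing about paths of probability zero; both sides vanish there.\<close>
  proof (cases "prob (path w) = 0")
    case True
    moreover have "prob (path w \<inter> next_y) \<le> prob (path w)"
      by (intro finite_measure_mono path_ev) auto
    ultimately show ?thesis using measure_nonneg[of M "path w \<inter> next_y"] by simp
  next
    case False
    then have pos: "prob (path w) > 0" by (simp add: less_le)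
    have wE: "\<forall>k\<le>n. w k \<in> E" and wn: "w n = x" using that by (auto simp: W_def)
    have "\<P>(\<omega> in M. X (Suc n) \<omega> = y \<bar> \<forall>k\<le>n. X k \<omega> = w k) = P x y"
      using markov_property[OF wE y] pos wn by (simp add: path_def)
    moreover have "{\<omega> \<in> space M. X (Suc n) \<omega> = y \<and> (\<forall>k\<le>n. X k \<omega> = w k)} = path w \<inter> next_y"
      by (auto simp: path_def next_y_def)
    ultimately show ?thesis
      using pos by (simp add: cond_prob_def path_def[symmetric] field_simps)
  qed
  have "{\<omega> \<in> space M. X n \<omega> = x \<and> X (Suc n) \<omega> = y} = (\<Union>w\<in>W. path w \<inter> next_y)"
    using union by (auto simp: next_y_def)
  also have "prob \<dots> = (\<Sum>w\<in>W. prob (path w \<inter> next_y))"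
    using disj by (intro finite_measure_finite_Union fin)
      (auto simp: disjoint_family_on_def path_ev next_ev)
  also have "\<dots> = (\<Sum>w\<in>W. prob (path w)) * P x y"
    by (simp add: step sum_distrib_right)
  also have "(\<Sum>w\<in>W. prob (path w)) = prob {\<omega> \<in> space M. X n \<omega> = x}"
    unfolding union using path_ev
    by (intro finite_measure_finite_Union[symmetric] fin disj) auto
  finally show ?thesis .
qed

lemma marginal_law:
  "y \<in> E \<Longrightarrow> \<P>(\<omega> in M. X n \<omega> = y) = vec_mat E \<nu> (mat_pow E P n) y"
proof (induction n arbitrary: y)
  case 0
  then show ?case
    using initial_law by (simp add: vec_mat_pow_0 finite_states del: mat_pow.simps)
next
  case (Suc n)
  have "{\<omega> \<in> space M. X (Suc n) \<omega> = y} = (\<Union>x\<in>E. {\<omega> \<in> space M. X n \<omega> = x \<and> X (Suc n) \<omega> = y})"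
    using state_in by auto
  also have "prob \<dots> = (\<Sum>x\<in>E. \<P>(\<omega> in M. X n \<omega> = x \<and> X (Suc n) \<omega> = y))"
    by (intro finite_measure_finite_Union finite_states) (auto simp: disjoint_family_on_def)
  also have "\<dots> = (\<Sum>x\<in>E. vec_mat E \<nu> (mat_pow E P n) x * P x y)"
    using Suc by (intro sum.cong refl) (simp add: transition_law)
  finally show ?case
    by (simp only: vec_mat_pow_Suc vec_mat_def[where K = P])
qed

text \<open>Almost surely the chain never leaves an absorbing state \<open>a\<close>, so being absorbed by time \<open>n\<close> is
  the same as being in \<open>a\<close> at time \<open>n\<close>.\<close>

lemma absorption_time_tail:
  assumes a: "a \<in> E" and absorbing: "P a a = 1"
  shows "\<P>(\<omega> in M. absorption_time X a \<omega> > enat n) = 1 - vec_mat E \<nu> (mat_pow E P n) a"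
proof -
  have "AE \<omega> in M. X k \<omega> = a \<longrightarrow> X (Suc k) \<omega> = a" for k
  proof (rule AE_I')
    let ?here = "{\<omega> \<in> space M. X k \<omega> = a}"
    let ?stay = "{\<omega> \<in> space M. X k \<omega> = a \<and> X (Suc k) \<omega> = a}"
    have "prob (?here - ?stay) = prob ?here - prob ?stay"
      by (intro finite_measure_Diff) auto
    also have "\<dots> = 0"
      using transition_law[OF a a, of k] absorbing by simp
    finally show "?here - ?stay \<in> null_sets M"
      by (intro null_setsI) (auto simp: emeasure_eq_measure)
  qed auto
  then have "AE \<omega> in M. \<forall>k. X k \<omega> = a \<longrightarrow> X (Suc k) \<omega> = a"
    by (simp add: AE_all_countable)
  then have "AE \<omega> in M. (absorption_time X a \<omega> > enat n) \<longleftrightarrow> X n \<omega> \<noteq> a"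
  proof eventually_elim
    case (elim \<omega>)
    have mono: "X n \<omega> = a" if "X k \<omega> = a" "k \<le> n" for k
      using that(2,1) elim by (induction rule: dec_induct) auto
    have "absorption_time X a \<omega> > enat n \<longleftrightarrow> (\<forall>k. X k \<omega> = a \<longrightarrow> Suc n \<le> k)"
      unfolding absorption_time_def Suc_ile_eq[symmetric] le_INF_iff by auto
    also have "\<dots> \<longleftrightarrow> X n \<omega> \<noteq> a"
      using mono by (metis not_less_eq_eq order_refl)
    finally show ?case .
  qed
  moreover have "{\<omega> \<in> space M. absorption_time X a \<omega> > enat n} \<in> events"
  proof -
    have "{\<omega> \<in> space M. absorption_time X a \<omega> > enat n} = {\<omega> \<in> space M. \<forall>k\<le>n. \<not> X k \<omega> = a}"
      unfolding absorption_time_def Suc_ile_eq[symmetric] le_INF_iff by (auto simp: not_less_eq_eq[symmetric])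
    also have "\<dots> \<in> events"
      using sets.sets_Collect_finite_All'[of "{..n}" M "\<lambda>k \<omega>. \<not> X k \<omega> = a"]
        sets.sets_Collect_neg[OF state_event] by auto
    finally show ?thesis .
  qed
  ultimately have "\<P>(\<omega> in M. absorption_time X a \<omega> > enat n) = \<P>(\<omega> in M. X n \<omega> \<noteq> a)"
    by (intro finite_measure_eq_AE) auto
  also have "\<dots> = 1 - \<P>(\<omega> in M. X n \<omega> = a)"
    by (rule prob_neg) simp
  finally show ?thesis
    by (simp add: marginal_law[OF a])
qed

end

section \<open>Separation from a dual chain\<close>

lemma intertwining_pow:
  assumes fin: "finite E" "finite E'"
    and init: "\<And>x. x \<in> E \<Longrightarrow> \<nu> x = vec_mat E' \<nu>' \<Lambda> x"
    and inter: "\<And>y x. y \<in> E' \<Longrightarrow> x \<in> E \<Longrightarrow> mat_prod E \<Lambda> P y x = mat_prod E' P' \<Lambda> y x"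
    and x: "x \<in> E"
  shows "vec_mat E \<nu> (mat_pow E P n) x = vec_mat E' (vec_mat E' \<nu>' (mat_pow E' P' n)) \<Lambda> x"
  using x
proof (induction n arbitrary: x)
  case 0
  then show ?case
    using fin init
    by (simp add: vec_mat_pow_0 vec_mat_cong[OF vec_mat_pow_0] del: mat_pow.simps)
next
  case (Suc n)
  let ?\<mu> = "vec_mat E' \<nu>' (mat_pow E' P' n)"
  have "vec_mat E \<nu> (mat_pow E P (Suc n)) x = vec_mat E (vec_mat E' ?\<mu> \<Lambda>) P x"
    unfolding vec_mat_pow_Suc using Suc.IH by (intro vec_mat_cong) auto
  also have "\<dots> = vec_mat E' ?\<mu> (mat_prod E' P' \<Lambda>) x"
    using inter Suc.prems by (simp only: vec_mat_assoc[of E]) (intro vec_mat_cong; simp)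
  finally show ?case
    by (simp only: vec_mat_assoc[symmetric] vec_mat_pow_Suc)
qed

text \<open>Write \<open>\<mu>\<close> for the law of the dual at time \<open>n\<close>. The law of the chain is the \<open>\<mu>\<close>-mixture of the
  rows of \<open>\<Lambda>\<close>; the row of \<open>a\<close> alone contributes \<open>\<mu> a * \<pi>\<close>, so the separation is at most
  \<open>1 - \<mu> a\<close>. At a state \<open>m\<close> charged by no other row this bound is attained.\<close>

lemma separation_eq_unabsorbed_mass:
  assumes fin: "finite E" "finite E'"
    and stoch: "stochastic_kernel E' E \<Lambda>" "stochastic_kernel E' E' P'" "distribution_on E' \<nu>'"
    and pos: "\<And>x. x \<in> E \<Longrightarrow> \<pi> x > 0"
    and a: "a \<in> E'" "\<And>x. x \<in> E \<Longrightarrow> \<Lambda> a x = \<pi> x"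
    and init: "\<And>x. x \<in> E \<Longrightarrow> \<nu> x = vec_mat E' \<nu>' \<Lambda> x"
    and inter: "\<And>y x. y \<in> E' \<Longrightarrow> x \<in> E \<Longrightarrow> mat_prod E \<Lambda> P y x = mat_prod E' P' \<Lambda> y x"
    and m: "m \<in> E" "\<And>y. y \<in> E' \<Longrightarrow> y \<noteq> a \<Longrightarrow> \<Lambda> y m = 0"
  shows "separation E (vec_mat E \<nu> (mat_pow E P n)) \<pi> = 1 - vec_mat E' \<nu>' (mat_pow E' P' n) a"
proof -
  let ?\<mu> = "vec_mat E' \<nu>' (mat_pow E' P' n)"
  have split: "vec_mat E \<nu> (mat_pow E P n) x = ?\<mu> a * \<pi> x + (\<Sum>y\<in>E'-{a}. ?\<mu> y * \<Lambda> y x)"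
    if "x \<in> E" for x
    using intertwining_pow[OF fin init inter that] a that fin
    by (simp add: vec_mat_def[where K = \<Lambda>] sum.remove)
  have "1 - vec_mat E \<nu> (mat_pow E P n) x / \<pi> x \<le> 1 - ?\<mu> a" if "x \<in> E" for x
  proof -
    have "(\<Sum>y\<in>E'-{a}. ?\<mu> y * \<Lambda> y x) \<ge> 0"
      using stoch(1) that vec_mat_pow_nonneg[OF fin(2) stoch(2,3)]
      by (intro sum_nonneg mult_nonneg_nonneg)
        (auto simp: stochastic_kernel_def distribution_on_def)
    then show ?thesis
      using pos[OF that] by (simp add: split[OF that] field_simps)
  qed
  moreover have "1 - vec_mat E \<nu> (mat_pow E P n) m / \<pi> m = 1 - ?\<mu> a"
    using pos[OF m(1)] m by (simp add: split)
  ultimately show ?thesis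
    unfolding separation_def using fin(1) m(1)
    by (intro Max_eqI) (auto intro: rev_image_eqI)
qed

section \<open>Duals of reversible chains linked by down-sets\<close>

text \<open>For a probability \<open>\<pi>\<close>, the row of \<open>e\<close> is \<open>\<pi>\<close> conditioned on the down-set of \<open>e\<close>.\<close>

definition down_link :: "'s set \<Rightarrow> ('s \<Rightarrow> 's \<Rightarrow> bool) \<Rightarrow> ('s \<Rightarrow> real) \<Rightarrow> 's \<Rightarrow> 's \<Rightarrow> real" where
  "down_link E le \<pi> e x = (if le x e then \<pi> x / (\<Sum>y | y \<in> E \<and> le y e. \<pi> y) else 0)"

text \<open>By reversibility, \<open>(\<Lambda> P)(e, x)\<close> is \<open>\<pi> x / H e\<close> times the probability of jumping from \<open>x\<close> into
  the down-set of \<open>e\<close>. In \<open>P' \<Lambda>\<close> the factor \<open>H e'\<close> of \<open>P'\<close> cancels the normalisation of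
  \<open>\<Lambda>(e', \<cdot>)\<close>, which leaves \<open>\<pi> x / H e\<close> times the mass that \<open>Q(e, \<cdot>)\<close> gives to the up-set
  of \<open>x\<close>.\<close>

lemma down_link_intertwines:
  fixes E :: "'s set" and \<pi> :: "'s \<Rightarrow> real" and le :: "'s \<Rightarrow> 's \<Rightarrow> bool"
  defines "H \<equiv> \<lambda>e. \<Sum>y | y \<in> E \<and> le y e. \<pi> y"
  assumes fin: "finite E"
    and rev: "\<And>x y. x \<in> E \<Longrightarrow> y \<in> E \<Longrightarrow> \<pi> x * P x y = \<pi> y * P y x"
    and H: "\<And>y. y \<in> E \<Longrightarrow> H y \<noteq> 0"
    and e: "e \<in> E" and x: "x \<in> E"
    and Q: "(\<Sum>e' | e' \<in> E \<and> le x e'. Q e e') = (\<Sum>y | y \<in> E \<and> le y e. P x y)"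
  shows "mat_prod E (down_link E le \<pi>) P e x =
    mat_prod E (\<lambda>e e'. H e' / H e * Q e e') (down_link E le \<pi>) e x"
proof -
  have "mat_prod E (down_link E le \<pi>) P e x = (\<Sum>y | y \<in> E \<and> le y e. \<pi> y * P y x / H e)"
    unfolding mat_prod_def using fin
    by (intro sum.mono_neutral_cong_right) (auto simp: down_link_def H_def)
  also have "\<dots> = (\<Sum>y | y \<in> E \<and> le y e. \<pi> x / H e * P x y)"
    using rev x by (intro sum.cong) auto
  also have "\<dots> = \<pi> x / H e * (\<Sum>e' | e' \<in> E \<and> le x e'. Q e e')"
    by (simp only: Q sum_distrib_left)
  also have "\<dots> = (\<Sum>e' | e' \<in> E \<and> le x e'. \<pi> x / H e * Q e e')"
    by (simp only: sum_distrib_left)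
  also have "\<dots> = mat_prod E (\<lambda>e e'. H e' / H e * Q e e') (down_link E le \<pi>) e x"
    unfolding mat_prod_def using fin H
    by (intro sum.mono_neutral_cong_left) (auto simp: down_link_def H_def)
  finally show ?thesis .
qed

lemma down_link_stochastic:
  assumes fin: "finite E" and refl: "\<And>x. x \<in> E \<Longrightarrow> le x x"
    and pos: "\<And>x. x \<in> E \<Longrightarrow> \<pi> x > 0"
  shows "stochastic_kernel E E (down_link E le \<pi>)"
proof -
  have H: "(\<Sum>y | y \<in> E \<and> le y e. \<pi> y) > 0" if "e \<in> E" for e
    using that fin refl pos by (intro sum_pos2[of _ e]) (auto simp: less_imp_le)
  have "(\<Sum>x\<in>E. down_link E le \<pi> e x) = 1" if "e \<in> E" for e
  proof -
    have "(\<Sum>x\<in>E. down_link E le \<pi> e x) =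
        (\<Sum>x | x \<in> E \<and> le x e. \<pi> x / (\<Sum>y | y \<in> E \<and> le y e. \<pi> y))"
      using fin by (intro sum.mono_neutral_cong_right) (auto simp: down_link_def)
    then show ?thesis
      using H[OF that] by (simp flip: sum_divide_distrib)
  qed
  then show ?thesis
    using H pos
    by (auto simp: stochastic_kernel_def distribution_on_def down_link_def less_imp_le)
qed

text \<open>Summing the intertwining relation over the states of \<open>E\<close> shows that every row of \<open>P'\<close> has
  mass one.\<close>

lemma intertwined_stochastic:
  assumes fin: "finite E" "finite E'"
    and P: "stochastic_kernel E E P" and L: "stochastic_kernel E' E \<Lambda>"
    and nonneg: "\<And>e e'. e \<in> E' \<Longrightarrow> e' \<in> E' \<Longrightarrow> P' e e' \<ge> 0"
    and inter: "\<And>y x. y \<in> E' \<Longrightarrow> x \<in> E \<Longrightarrow> mat_prod E \<Lambda> P y x = mat_prod E' P' \<Lambda> y x"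
  shows "stochastic_kernel E' E' P'"
proof -
  have sums: "(\<Sum>x\<in>E. mat_prod F K L e x) = (\<Sum>y\<in>F. K e y)"
    if "\<And>y. y \<in> F \<Longrightarrow> (\<Sum>x\<in>E. L y x) = 1" for F :: "'c set" and K :: "'b \<Rightarrow> 'c \<Rightarrow> real" and L e
    unfolding mat_prod_def by (subst sum.swap) (simp add: sum_distrib_left[symmetric] that)
  have "(\<Sum>e'\<in>E'. P' e e') = 1" if "e \<in> E'" for e
  proof -
    have "(\<Sum>e'\<in>E'. P' e e') = (\<Sum>x\<in>E. mat_prod E' P' \<Lambda> e x)"
      using L by (subst sums) (auto simp: stochastic_kernel_def distribution_on_def)
    also have "\<dots> = (\<Sum>x\<in>E. mat_prod E \<Lambda> P e x)"
      using inter that by (intro sum.cong) auto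
    also have "\<dots> = (\<Sum>y\<in>E. \<Lambda> e y)"
      using P by (subst sums) (auto simp: stochastic_kernel_def distribution_on_def)
    finally show ?thesis
      using L that by (simp add: stochastic_kernel_def distribution_on_def)
  qed
  then show ?thesis
    using nonneg by (simp add: stochastic_kernel_def distribution_on_def)
qed

section \<open>Configurations and local update probabilities\<close>

lemma finite_configs: "finite (configs N)"
  unfolding configs_def by (intro finite_PiE) auto

lemma configs_spin: "e \<in> configs N \<Longrightarrow> i < N \<Longrightarrow> e i = -1 \<or> e i = 1"
  by (auto simp: configs_def)

lemma configs_upd: "e \<in> configs N \<Longrightarrow> i < N \<Longrightarrow> s = -1 \<or> s = 1 \<Longrightarrow> e(i := s) \<in> configs N"
  by (auto simp: configs_def PiE_iff extensional_def)

lemma config_eqI: "e \<in> configs N \<Longrightarrow> f \<in> configs N \<Longrightarrow> (\<And>i. i < N \<Longrightarrow> e i = f i) \<Longrightarrow> e = f"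
  unfolding configs_def by (erule PiE_ext) auto

lemma all_minus_configs: "all_minus N \<in> configs N"
  and all_plus_configs: "all_plus N \<in> configs N"
  by (auto simp: configs_def all_minus_def all_plus_def)

text \<open>The clockwise and counterclockwise neighbours on the circle; \<open>N - 1\<close> is added before
  reduction because subtraction on \<open>nat\<close> truncates.\<close>

definition cw :: "nat \<Rightarrow> nat \<Rightarrow> nat" where "cw N i = (i + 1) mod N"
definition ccw :: "nat \<Rightarrow> nat \<Rightarrow> nat" where "ccw N i = (i + N - 1) mod N"

lemma cw_if: "i < N \<Longrightarrow> cw N i = (if i = N - 1 then 0 else i + 1)"
  and ccw_if: "i < N \<Longrightarrow> ccw N i = (if i = 0 then N - 1 else i - 1)"
  by (auto simp: cw_def ccw_def mod_if)

lemma cw_less: "i < N \<Longrightarrow> cw N i < N" and ccw_less: "i < N \<Longrightarrow> ccw N i < N"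
  by (auto simp: cw_def ccw_def)

lemma cw_eq_iff: "i < N \<Longrightarrow> j < N \<Longrightarrow> cw N j = i \<longleftrightarrow> j = ccw N i"
  by (auto simp: cw_if ccw_if)

text \<open>On a circle with two vertices the two neighbours would coincide; from three vertices on, every
  site has exactly two.\<close>

lemma circle_distinct:
  assumes "N \<ge> 3" "i < N"
  shows "cw N i \<noteq> i" "ccw N i \<noteq> i" "cw N i \<noteq> ccw N i"
  using assms by (auto simp: cw_if ccw_if)

lemma neighbours_eq:
  assumes "N \<ge> 3" "i < N"
  shows "neighbours N i = {cw N i, ccw N i}"
proof -
  have "neighbours N i = {j. \<exists>k<N. {i, j} = {k, cw N k}}"
    by (auto simp: neighbours_def circle_edges_def cw_def)
  also have "\<dots> = {j. j = cw N i \<or> j < N \<and> cw N j = i}"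
    using assms(2) by (auto simp: doubleton_eq_iff)
  also have "\<dots> = {cw N i, ccw N i}"
    using cw_eq_iff[OF assms(2)] ccw_less[OF assms(2)] by auto
  finally show ?thesis .
qed

definition spin_field :: "nat \<Rightarrow> config \<Rightarrow> nat \<Rightarrow> int" where
  "spin_field N e i = e (cw N i) + e (ccw N i)"

lemma k_diff_eq_spin_field:
  assumes "N \<ge> 3" "i < N" "e \<in> configs N"
  shows "real (k_plus N i e) - real (k_minus N i e) = real_of_int (spin_field N e i)"
proof -
  have *: "{j \<in> {cw N i, ccw N i}. Q j} =
      (if Q (cw N i) then {cw N i} else {}) \<union> (if Q (ccw N i) then {ccw N i} else {})" for Q
    by auto
  show ?thesis
    using configs_spin[OF assms(3) cw_less[OF assms(2)]]
      configs_spin[OF assms(3) ccw_less[OF assms(2)]] circle_distinct[OF assms(1,2)]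
    unfolding k_plus_def k_minus_def neighbours_eq[OF assms(1,2)] * spin_field_def by auto
qed

definition update_prob :: "nat \<Rightarrow> real \<Rightarrow> nat \<Rightarrow> config \<Rightarrow> int \<Rightarrow> real" where
  "update_prob N \<beta> i e s = (if s = 1 then up_prob N \<beta> i e else 1 - up_prob N \<beta> i e)"

lemma update_prob_eq:
  assumes "N \<ge> 3" "i < N" "e \<in> configs N" "s = -1 \<or> s = 1"
  shows "update_prob N \<beta> i e s = exp (\<beta> * s * spin_field N e i) / (exp (\<beta> * spin_field N e i) + exp (- (\<beta> * spin_field N e i)))"
proof -
  define t where "t = \<beta> * spin_field N e i"
  have "exp (2 * t) / (exp (2 * t) + 1) = exp t / (exp t + exp (- t))"
    unfolding mult_2 exp_add by (simp add: exp_minus divide_simps)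
  moreover have "1 - exp t / (exp t + exp (- t)) = exp (- t) / (exp t + exp (- t))"
    using add_pos_pos[of "exp t" "exp (- t)"] by (simp add: divide_simps)
  ultimately show ?thesis
    using assms by (auto simp: update_prob_def up_prob_def k_diff_eq_spin_field t_def mult.assoc)
qed

lemma update_prob_pos:
  assumes "N \<ge> 3" "i < N" "e \<in> configs N" "s = -1 \<or> s = 1"
  shows "update_prob N \<beta> i e s > 0"
  by (simp add: update_prob_eq[OF assms] add_pos_pos)

lemma spin_field_cong:
  assumes "N \<ge> 3" "i < N" "\<And>j. j \<noteq> i \<Longrightarrow> e j = f j"
  shows "spin_field N e i = spin_field N f i"
  using circle_distinct[OF assms(1,2)] assms(3) by (simp add: spin_field_def)

text \<open>Half of \<open>tanh (2 * \<beta>)\<close>: the drop of the probability of updating to \<open>-1\<close> when a single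
  neighbour is turned from \<open>-1\<close> to \<open>+1\<close>.\<close>

definition bias :: "real \<Rightarrow> real" where
  "bias \<beta> = 1 / 2 - 1 / (exp (4 * \<beta>) + 1)"

lemma bias_nonneg:
  assumes "\<beta> \<ge> 0"
  shows "bias \<beta> \<ge> 0"
proof -
  have "exp (4 * \<beta>) \<ge> 1" using assms by simp
  then have "1 / (exp (4 * \<beta>) + 1) \<le> 1 / 2" by (intro frac_le) auto
  then show ?thesis by (simp add: bias_def)
qed

text \<open>The neighbour sum only takes the values \<open>-2\<close>, \<open>0\<close> and \<open>2\<close>. Flipping all spins exchanges
  the outer two probabilities with their complements and fixes the middle one at \<open>1/2\<close>, so the
  three points lie on a line.\<close>

lemma down_prob_affine:
  assumes "N \<ge> 3" "i < N" "e \<in> configs N"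
  shows "1 - up_prob N \<beta> i e = 1 / 2 - bias \<beta> / 2 * real_of_int (spin_field N e i)"
proof -
  have "exp (2 * \<beta> * (-2)) = inverse (exp (4 * \<beta>))"
    by (simp flip: exp_minus)
  moreover have "1 + exp (\<beta> * 4) \<noteq> 0" "1 + exp (- (\<beta> * 4)) \<noteq> 0"
    by (simp_all add: add_pos_pos less_imp_neq[symmetric])
  ultimately have "1 - exp (2 * \<beta> * d) / (exp (2 * \<beta> * d) + 1) = 1 / 2 - bias \<beta> / 2 * d"
    if "d = -2 \<or> d = 0 \<or> d = 2" for d :: real
    using that by (auto simp: bias_def divide_simps add_pos_pos) (simp_all add: algebra_simps)
  moreover have "real_of_int (spin_field N e i) = -2 \<or> real_of_int (spin_field N e i) = 0 \<or> real_of_int (spin_field N e i) = 2"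
    using configs_spin[OF assms(3) cw_less[OF assms(2)]]
      configs_spin[OF assms(3) ccw_less[OF assms(2)]] by (auto simp: spin_field_def)
  ultimately show ?thesis
    by (simp add: up_prob_def k_diff_eq_spin_field[OF assms])
qed

text \<open>Isolates the spin at \<open>i\<close>: it enters only the two bonds at \<open>i\<close>, and these are summed with
  index \<open>i\<close> and \<open>ccw N i\<close>.\<close>

lemma ising_weight_split:
  assumes "N \<ge> 3" "i < N"
  shows "ising_weight N \<beta> e = exp (\<beta> * (\<Sum>k\<in>{..<N} - {i, ccw N i}. e k * e (cw N k)))
    * exp (\<beta> * e i * spin_field N e i)"
proof -
  have "(\<Sum>k<N. e k * e (cw N k)) = e i * e (cw N i) + e (ccw N i) * e (cw N (ccw N i))
      + (\<Sum>k\<in>{..<N} - {i, ccw N i}. e k * e (cw N k))"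
    using assms ccw_less[of i N] circle_distinct[OF assms]
    by (subst sum.subset_diff[of "{i, ccw N i}"]) auto
  also have "cw N (ccw N i) = i"
    using cw_eq_iff[of i N "ccw N i"] assms ccw_less by simp
  finally have "(\<Sum>k<N. e k * e (cw N k)) =
      (\<Sum>k\<in>{..<N} - {i, ccw N i}. e k * e (cw N k)) + e i * spin_field N e i"
    by (simp add: spin_field_def algebra_simps)
  moreover have "ising_weight N \<beta> e = exp (\<beta> * real_of_int (\<Sum>k<N. e k * e (cw N k)))"
    by (simp add: ising_weight_def cw_def)
  ultimately show ?thesis
    by (simp only: exp_add[symmetric] of_int_add of_int_mult distrib_left mult.assoc)
qed

section \<open>Reversibility and ergodicity of the Gibbs sampler\<close>

lemma gibbs_matrix_eq:
  assumes "N > 0"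
  shows "gibbs_matrix N \<beta> x y = (\<Sum>i<N. update_prob N \<beta> i x 1 * (if y = x(i := 1) then 1 else 0)
      + update_prob N \<beta> i x (-1) * (if y = x(i := -1) then 1 else 0)) / real N"
proof -
  have up: "0 \<le> up_prob N \<beta> i x" "up_prob N \<beta> i x \<le> 1" for i
    by (auto simp: up_prob_def divide_simps add_pos_pos)
  have "pmf (map_pmf (\<lambda>up. x(i := if up then 1 else -1)) (bernoulli_pmf (up_prob N \<beta> i x))) y =
      update_prob N \<beta> i x 1 * (if y = x(i := 1) then 1 else 0)
      + update_prob N \<beta> i x (-1) * (if y = x(i := -1) then 1 else 0)" for i
    using up[of i]
    by (simp add: map_pmf_def pmf_bind integral_measure_pmf_real[where A = UNIV] update_prob_def
        UNIV_bool indicator_def pmf_return eq_commute[of y])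
  then show ?thesis
    using assms
    by (subst gibbs_matrix_def, subst gibbs_step_def, subst pmf_bind_pmf_of_set) auto
qed

lemma gibbs_matrix_eq_configs:
  assumes N: "N \<ge> 3" and x: "x \<in> configs N" and y: "y \<in> configs N"
  shows "gibbs_matrix N \<beta> x y =
    (\<Sum>i<N. if y = x(i := y i) then update_prob N \<beta> i x (y i) else 0) / real N"
proof -
  have "gibbs_matrix N \<beta> x y = (\<Sum>i<N. update_prob N \<beta> i x 1 * (if y = x(i := 1) then 1 else 0)
      + update_prob N \<beta> i x (-1) * (if y = x(i := -1) then 1 else 0)) / real N"
    using N by (intro gibbs_matrix_eq) simp
  also have "(\<Sum>i<N. update_prob N \<beta> i x 1 * (if y = x(i := 1) then 1 else 0)
      + update_prob N \<beta> i x (-1) * (if y = x(i := -1) then 1 else 0)) =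
      (\<Sum>i<N. if y = x(i := y i) then update_prob N \<beta> i x (y i) else 0)"
  proof (intro sum.cong refl)
    fix i assume "i \<in> {..<N}"
    then have yi: "y i = -1 \<or> y i = 1" using configs_spin[OF y] by simp
    define upd where "upd \<longleftrightarrow> y = x(i := y i)"
    have upd: "y = x(i := 1) \<longleftrightarrow> upd \<and> y i = 1" "y = x(i := -1) \<longleftrightarrow> upd \<and> y i = -1"
      unfolding upd_def by (metis fun_upd_same)+
    show "update_prob N \<beta> i x 1 * (if y = x(i := 1) then 1 else 0)
        + update_prob N \<beta> i x (-1) * (if y = x(i := -1) then 1 else 0) =
        (if y = x(i := y i) then update_prob N \<beta> i x (y i) else 0)"
      unfolding upd upd_def[symmetric] using yi by auto
  qed
  finally show ?thesis .
qed

lemma gibbs_matrix_stochastic: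
  assumes N: "N \<ge> 3"
  shows "stochastic_kernel (configs N) (configs N) (gibbs_matrix N \<beta>)"
proof -
  have delta: "(\<Sum>y\<in>configs N. c * (if y = z then 1 else 0)) = c" if "z \<in> configs N" for c :: real and z
    using that by (simp add: finite_configs flip: sum_distrib_left)
  have "(\<Sum>y\<in>configs N. gibbs_matrix N \<beta> x y) = 1" if x: "x \<in> configs N" for x
  proof -
    have "(\<Sum>y\<in>configs N. gibbs_matrix N \<beta> x y) =
      (\<Sum>i<N. \<Sum>y\<in>configs N. update_prob N \<beta> i x 1 * (if y = x(i := 1) then 1 else 0)
        + update_prob N \<beta> i x (-1) * (if y = x(i := -1) then 1 else 0)) / real N"
      using N by (simp add: gibbs_matrix_eq flip: sum_divide_distrib) (rule sum.swap)
    also have "\<dots> = (\<Sum>i<N. 1) / real N"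
      using x by (intro arg_cong2[where f = divide] sum.cong refl)
        (simp add: sum.distrib delta configs_upd update_prob_def)
    finally show ?thesis using N by simp
  qed
  then show ?thesis
    by (simp add: stochastic_kernel_def distribution_on_def gibbs_matrix_def)
qed

lemma ising_dist_pos: "ising_dist N \<beta> e > 0"
proof -
  have "(\<Sum>e\<in>configs N. ising_weight N \<beta> e) > 0"
    using all_minus_configs finite_configs
    by (intro sum_pos) (auto simp: ising_weight_def)
  then show ?thesis by (simp add: ising_dist_def ising_weight_def)
qed

lemma ising_dist_distribution: "distribution_on (configs N) (ising_dist N \<beta>)"
proof -
  have "(\<Sum>e\<in>configs N. ising_weight N \<beta> e) > 0"
    using all_minus_configs finite_configs
    by (intro sum_pos) (auto simp: ising_weight_def)
  then have "(\<Sum>e\<in>configs N. ising_dist N \<beta> e) = 1"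
    by (simp add: ising_dist_def flip: sum_divide_distrib)
  then show ?thesis
    using ising_dist_pos by (simp add: distribution_on_def less_imp_le)
qed

text \<open>Detailed balance holds for each site separately: an update at \<open>i\<close> leaves the neighbour sum
  \<open>h\<close> at \<open>i\<close> and all other bonds unchanged, and up to these the flow from spin \<open>s\<close> to spin
  \<open>t\<close> is proportional to \<open>exp (\<beta> * s * h) * exp (\<beta> * t * h)\<close>, which is symmetric.\<close>

lemma gibbs_reversible:
  assumes N: "N \<ge> 3" and x: "x \<in> configs N" and y: "y \<in> configs N"
  shows "ising_dist N \<beta> x * gibbs_matrix N \<beta> x y = ising_dist N \<beta> y * gibbs_matrix N \<beta> y x"
proof -
  have "ising_weight N \<beta> x * (if y = x(i := y i) then update_prob N \<beta> i x (y i) else 0) =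
      ising_weight N \<beta> y * (if x = y(i := x i) then update_prob N \<beta> i y (x i) else 0)"
    if i: "i < N" for i
  proof (cases "y = x(i := y i)")
    case True
    then have off: "x j = y j" if "j \<noteq> i" for j using that by (metis fun_upd_other)
    then have undo: "x = y(i := x i)" by auto
    have fld: "spin_field N y i = spin_field N x i"
      by (rule spin_field_cong[OF N i]) (simp add: off)
    have "x k * x (cw N k) = y k * y (cw N k)" if "k \<in> {..<N} - {i, ccw N i}" for k
      using that off cw_eq_iff[OF i, of k] by auto
    then have rest: "(\<Sum>k\<in>{..<N} - {i, ccw N i}. x k * x (cw N k)) =
        (\<Sum>k\<in>{..<N} - {i, ccw N i}. y k * y (cw N k))"
      by (intro sum.cong) auto
    show ?thesis
      using True undo configs_spin[OF x i] configs_spin[OF y i]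
      by (simp add: ising_weight_split[OF N i] update_prob_eq[OF N i] x y fld rest)
  next
    case False
    then have "x \<noteq> y(i := x i)" by (metis fun_upd_triv fun_upd_upd)
    with False show ?thesis by simp
  qed
  then show ?thesis
    by (simp add: gibbs_matrix_eq_configs[OF N] x y ising_dist_def sum_distrib_left)
qed

lemma gibbs_stationary:
  assumes N: "N \<ge> 3"
  shows "stationary_distribution (configs N) (gibbs_matrix N \<beta>) (ising_dist N \<beta>)"
proof -
  have "vec_mat (configs N) (ising_dist N \<beta>) (gibbs_matrix N \<beta>) y = ising_dist N \<beta> y"
    if y: "y \<in> configs N" for y
  proof -
    have "vec_mat (configs N) (ising_dist N \<beta>) (gibbs_matrix N \<beta>) y =
        (\<Sum>x\<in>configs N. ising_dist N \<beta> y * gibbs_matrix N \<beta> y x)"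
      unfolding vec_mat_def using gibbs_reversible[OF N _ y] by (intro sum.cong) auto
    then show ?thesis
      using gibbs_matrix_stochastic[OF N, of \<beta>] y
      by (simp add: stochastic_kernel_def distribution_on_def flip: sum_distrib_left)
  qed
  then show ?thesis
    using ising_dist_distribution by (simp add: stationary_distribution_def)
qed

lemma gibbs_update_pos:
  assumes N: "N \<ge> 3" and x: "x \<in> configs N" and i: "i < N" and s: "s = -1 \<or> s = 1"
  shows "gibbs_matrix N \<beta> x (x(i := s)) > 0"
proof -
  let ?y = "x(i := s)"
  have y: "?y \<in> configs N" by (rule configs_upd[OF x i s])
  have "(\<Sum>j<N. if ?y = x(j := ?y j) then update_prob N \<beta> j x (?y j) else 0) > 0"
  proof (rule sum_pos2)
    show "0 < (if ?y = x(i := ?y i) then update_prob N \<beta> i x (?y i) else 0)"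
      using update_prob_pos[OF N i x s] by simp
    show "0 \<le> (if ?y = x(j := ?y j) then update_prob N \<beta> j x (?y j) else 0)" if "j \<in> {..<N}" for j
      using update_prob_pos[OF N _ x configs_spin[OF y]] that by (simp add: less_imp_le)
  qed (use i in auto)
  then show ?thesis
    using N by (simp only: gibbs_matrix_eq_configs[OF N x y]) simp
qed

text \<open>Setting the spins of the target one after the other connects any two configurations in exactly
  \<open>N\<close> steps, and an update may leave the spin as it is, which gives aperiodicity.\<close>

lemma gibbs_ergodic:
  assumes N: "N \<ge> 3"
  shows "ergodic_on (configs N) (gibbs_matrix N \<beta>)"
proof -
  note stoch = gibbs_matrix_stochastic[OF N, of \<beta>]
  let ?P = "gibbs_matrix N \<beta>"
  have step: "mat_pow (configs N) ?P (Suc n) x z > 0"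
    if "mat_pow (configs N) ?P n x y > 0" "?P y z > 0" "x \<in> configs N" "y \<in> configs N" "z \<in> configs N"
    for n x y z
    unfolding mat_pow.simps mat_prod_def
    using that mat_pow_nonneg[OF stoch] stoch
    by (intro sum_pos2[OF finite_configs, of y] mult_nonneg_nonneg)
      (auto simp: stochastic_kernel_def distribution_on_def)
  have "mat_pow (configs N) ?P N x y > 0" if x: "x \<in> configs N" and y: "y \<in> configs N" for x y
  proof -
    \<comment> \<open>The configuration after the first \<open>n\<close> sites have been set to their target values.\<close>
    define mix where "mix n = (\<lambda>i. if i < n then y i else x i)" for n
    have mixE: "mix n \<in> configs N" if "n \<le> N" for n
      using x y that by (auto simp: mix_def configs_def PiE_iff extensional_def)
    have "n \<le> N \<Longrightarrow> mat_pow (configs N) ?P n x (mix n) > 0" for n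
    proof (induction n)
      case 0
      then show ?case by (simp add: mix_def)
    next
      case (Suc n)
      have "mix (Suc n) = (mix n)(n := y n)" by (auto simp: mix_def less_Suc_eq)
      then have "?P (mix n) (mix (Suc n)) > 0"
        using gibbs_update_pos[OF N mixE[of n] _ configs_spin[OF y], of n n] Suc.prems by simp
      then show ?case
        using Suc x mixE by (intro step[of n x "mix n"]) auto
    qed
    moreover have "mix N = y"
      using x y by (auto simp: mix_def configs_def PiE_iff extensional_def)
    ultimately show ?thesis by (metis order_refl)
  qed
  then have "irreducible_on (configs N) ?P"
    unfolding irreducible_on_def by blast
  moreover have "aperiodic_on (configs N) ?P"
    unfolding aperiodic_on_def
  proof
    fix x assume x: "x \<in> configs N"
    have "?P x x > 0"
      using gibbs_update_pos[OF N x _ configs_spin[OF x], of 0 0] N by simp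
    then have "mat_pow (configs N) ?P (Suc 0) x x > 0"
      using x by (intro step) auto
    then have "1 \<in> {n. n \<ge> 1 \<and> mat_pow (configs N) ?P n x x > 0}" by simp
    from Gcd_dvd_nat[OF this] show "Gcd {n. n \<ge> 1 \<and> mat_pow (configs N) ?P n x x > 0} = 1"
      by (simp only: nat_dvd_1_iff_1)
  qed
  ultimately show ?thesis by (simp add: ergodic_on_def)
qed

section \<open>Moebius inversion for the Gibbs sampler\<close>

text \<open>Moebius inverse of the contribution of site \<open>j\<close> to \<open>x \<mapsto> P(x, {y. y \<preceq> e})\<close>, before
  division by \<open>N\<close>. The configuration in which both neighbours of \<open>j\<close> are lowered gets no mass,
  because the update probability is affine in the neighbour sum.\<close>

definition site_dual :: "nat \<Rightarrow> real \<Rightarrow> nat \<Rightarrow> config \<Rightarrow> config \<Rightarrow> real" where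
  "site_dual N \<beta> j e e' =
    (if e j = 1 then of_bool (e' = e)
     else (1 - up_prob N \<beta> j e) * of_bool (e' = e(j := 1)) +
       (\<Sum>i\<in>{cw N j, ccw N j}.
          (if e i = 1 then bias \<beta> else 0) * of_bool (e' = e(j := 1, i := -1))))"

definition dual_weight :: "nat \<Rightarrow> real \<Rightarrow> config \<Rightarrow> config \<Rightarrow> real" where
  "dual_weight N \<beta> e e' = (\<Sum>j<N. site_dual N \<beta> j e e') / real N"

lemma dual_weight_nonneg:
  assumes "N \<ge> 3" "\<beta> \<ge> 0" "e \<in> configs N"
  shows "dual_weight N \<beta> e e' \<ge> 0"
proof -
  have "1 - up_prob N \<beta> j e \<ge> 0" if "j < N" for j
    using update_prob_pos[OF assms(1) that assms(3), of "-1" \<beta>] by (simp add: update_prob_def)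
  then show ?thesis
    unfolding dual_weight_def site_dual_def using bias_nonneg[OF assms(2)]
    by (auto intro!: divide_nonneg_nonneg sum_nonneg add_nonneg_nonneg mult_nonneg_nonneg)
qed

lemma sum_point:
  "finite S \<Longrightarrow> (\<Sum>y\<in>S. c * of_bool (y = z)) = (c * of_bool (z \<in> S) :: real)"
  by (simp add: of_bool_def flip: sum_distrib_left)

text \<open>If \<open>x\<close> lies below \<open>e\<close> with \<open>j\<close> raised, then the neighbour sums of \<open>e\<close> and \<open>x\<close> at
  \<open>j\<close> differ by twice the number of neighbours that are \<open>+1\<close> in \<open>e\<close> and \<open>-1\<close> in \<open>x\<close>. These
  are the \<open>+1\<close> neighbours \<open>i\<close> of \<open>j\<close> in \<open>e\<close> for which \<open>x\<close> still lies below \<open>e\<close> with \<open>j\<close>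
  raised and \<open>i\<close> lowered, and by affinity each of them accounts for one \<open>bias\<close>.\<close>

lemma dual_weight_local:
  assumes N: "N \<ge> 3" and j: "j < N" and x: "x \<in> configs N" and e: "e \<in> configs N"
    and ej: "e j = -1"
  shows "(1 - up_prob N \<beta> j e) * of_bool (config_le N x (e(j := 1))) +
      (\<Sum>i\<in>{cw N j, ccw N j}.
        (if e i = 1 then bias \<beta> else 0) * of_bool (config_le N x (e(j := 1, i := -1)))) =
    (1 - up_prob N \<beta> j x) * of_bool (config_le N x (e(j := 1)))"
proof (cases "config_le N x (e(j := 1))")
  case False
  have "\<not> config_le N x (e(j := 1, i := -1))" if "e i = 1" for i
  proof
    assume le: "config_le N x (e(j := 1, i := -1))"
    have "config_le N x (e(j := 1))"
      unfolding config_le_def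
    proof (intro allI impI)
      fix k assume "k < N"
      then have "x k \<le> (e(j := 1, i := -1)) k" using le by (simp add: config_le_def)
      also have "\<dots> \<le> (e(j := 1)) k" using that ej by auto
      finally show "x k \<le> (e(j := 1)) k" .
    qed
    with False show False by simp
  qed
  with False show ?thesis by (auto intro!: sum.neutral)
next
  case True
  have lower: "config_le N x (e(j := 1, i := -1)) \<longleftrightarrow> x i = -1" if "i < N" "i \<noteq> j" for i
    using True that configs_spin[OF x that(1)] by (auto simp: config_le_def)
  note nb = cw_less[OF j] ccw_less[OF j] circle_distinct[OF N j]
  have le: "x (cw N j) \<le> e (cw N j)" "x (ccw N j) \<le> e (ccw N j)"
    using True nb by (auto simp: config_le_def split: if_splits)
  have "(1 - up_prob N \<beta> j e) + ((if e (cw N j) = 1 then bias \<beta> else 0) * of_bool (x (cw N j) = -1) +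
      (if e (ccw N j) = 1 then bias \<beta> else 0) * of_bool (x (ccw N j) = -1)) = 1 - up_prob N \<beta> j x"
    using le configs_spin[OF x nb(1)] configs_spin[OF x nb(2)]
      configs_spin[OF e nb(1)] configs_spin[OF e nb(2)]
    unfolding down_prob_affine[OF N j x] down_prob_affine[OF N j e] spin_field_def by auto
  moreover have "(\<Sum>i\<in>{cw N j, ccw N j}.
        (if e i = 1 then bias \<beta> else 0) * of_bool (config_le N x (e(j := 1, i := -1)))) =
      (if e (cw N j) = 1 then bias \<beta> else 0) * of_bool (x (cw N j) = -1) +
      (if e (ccw N j) = 1 then bias \<beta> else 0) * of_bool (x (ccw N j) = -1)"
    using nb by (simp add: lower)
  ultimately show ?thesis
    using True by (simp only: of_bool_eq mult_1_right)
qed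

lemma sum_site_dual_above:
  assumes N: "N \<ge> 3" and j: "j < N" and x: "x \<in> configs N" and e: "e \<in> configs N"
  shows "(\<Sum>e' | e' \<in> configs N \<and> config_le N x e'. site_dual N \<beta> j e e') =
    (if e j = 1 then of_bool (config_le N x e)
     else (1 - up_prob N \<beta> j x) * of_bool (config_le N x (e(j := 1))))"
proof -
  let ?U = "{e'. e' \<in> configs N \<and> config_le N x e'}"
  have fin: "finite ?U" by (simp add: finite_configs)
  show ?thesis
  proof (cases "e j = 1")
    case True
    then show ?thesis
      using sum_point[OF fin, of 1 e] e by (simp add: site_dual_def)
  next
    case False
    then have ej: "e j = -1" using configs_spin[OF e j] by simp
    have up: "e(j := 1) \<in> configs N" using e j by (intro configs_upd) auto
    have upd: "e(j := 1, i := -1) \<in> configs N" if "i \<in> {cw N j, ccw N j}" for i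
      using that up cw_less[OF j] ccw_less[OF j] by (intro configs_upd[OF up]) auto
    have "(\<Sum>e'\<in>?U. site_dual N \<beta> j e e') =
        (\<Sum>e'\<in>?U. (1 - up_prob N \<beta> j e) * of_bool (e' = e(j := 1))) +
        (\<Sum>i\<in>{cw N j, ccw N j}. \<Sum>e'\<in>?U.
          (if e i = 1 then bias \<beta> else 0) * of_bool (e' = e(j := 1, i := -1)))"
      unfolding site_dual_def if_not_P[OF False] sum.distrib
      by (rule arg_cong2[where f = "(+)", OF refl sum.swap])
    also have "\<dots> = (1 - up_prob N \<beta> j e) * of_bool (config_le N x (e(j := 1))) +
        (\<Sum>i\<in>{cw N j, ccw N j}.
          (if e i = 1 then bias \<beta> else 0) * of_bool (config_le N x (e(j := 1, i := -1))))"
      unfolding sum_point[OF fin] using up upd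
      by (intro arg_cong2[where f = "(+)"] sum.cong refl) simp_all
    finally show ?thesis
      using False by (simp only: dual_weight_local[OF N j x e ej] if_False)
  qed
qed

text \<open>The update overwrites \<open>x j\<close>, so it ends below \<open>e\<close> exactly when the new spin is at most
  \<open>e j\<close> and \<open>x\<close> is below \<open>e\<close> at all other sites; the latter is \<open>x \<preceq> e(j := 1)\<close>.\<close>

lemma sum_site_update_below:
  assumes j: "j < N" and x: "x \<in> configs N" and e: "e \<in> configs N"
  shows "(\<Sum>y | y \<in> configs N \<and> config_le N y e.
      update_prob N \<beta> j x 1 * of_bool (y = x(j := 1)) +
      update_prob N \<beta> j x (-1) * of_bool (y = x(j := -1))) =
    (if e j = 1 then of_bool (config_le N x e)
     else (1 - up_prob N \<beta> j x) * of_bool (config_le N x (e(j := 1))))"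
proof -
  let ?D = "{y. y \<in> configs N \<and> config_le N y e}"
  have fin: "finite ?D" by (simp add: finite_configs)
  have upd: "x(j := s) \<in> ?D \<longleftrightarrow> s \<le> e j \<and> config_le N x (e(j := 1))" if "s = -1 \<or> s = 1" for s
  proof -
    have low: "config_le N (x(j := s)) e \<longleftrightarrow> s \<le> e j \<and> (\<forall>i<N. i \<noteq> j \<longrightarrow> x i \<le> e i)"
      using j unfolding config_le_def by (metis fun_upd_apply)
    have off: "(\<forall>i<N. i \<noteq> j \<longrightarrow> x i \<le> e i) \<longleftrightarrow> config_le N x (e(j := 1))"
      using configs_spin[OF x j] unfolding config_le_def by fastforce
    show ?thesis
      using configs_upd[OF x j that] by (simp only: mem_Collect_eq low off simp_thms)
  qed
  have "(\<Sum>y\<in>?D. update_prob N \<beta> j x 1 * of_bool (y = x(j := 1)) +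
      update_prob N \<beta> j x (-1) * of_bool (y = x(j := -1))) =
    up_prob N \<beta> j x * of_bool (1 \<le> e j \<and> config_le N x (e(j := 1))) +
    (1 - up_prob N \<beta> j x) * of_bool (-1 \<le> e j \<and> config_le N x (e(j := 1)))"
    unfolding sum.distrib sum_point[OF fin] upd[OF disjI1[OF refl]] upd[OF disjI2[OF refl]]
    by (simp add: update_prob_def)
  also have "\<dots> = (if e j = 1 then of_bool (config_le N x e)
     else (1 - up_prob N \<beta> j x) * of_bool (config_le N x (e(j := 1))))"
  proof (cases "e j = 1")
    case True
    then have "e(j := 1) = e" by auto
    with True show ?thesis by simp
  next
    case False
    then show ?thesis using configs_spin[OF e j] by simp
  qed
  finally show ?thesis .
qed

text \<open>Both sides are averages over the updated site, and they agree site by site. This is the mass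
  condition under which the down-set link intertwines the sampler with the dual.\<close>

lemma dual_weight_moebius:
  assumes N: "N \<ge> 3" and x: "x \<in> configs N" and e: "e \<in> configs N"
  shows "(\<Sum>e' | e' \<in> configs N \<and> config_le N x e'. dual_weight N \<beta> e e') =
    (\<Sum>y | y \<in> configs N \<and> config_le N y e. gibbs_matrix N \<beta> x y)"
proof -
  let ?U = "{e'. e' \<in> configs N \<and> config_le N x e'}"
  let ?D = "{y. y \<in> configs N \<and> config_le N y e}"
  have "(\<Sum>e'\<in>?U. dual_weight N \<beta> e e') = (\<Sum>j<N. \<Sum>e'\<in>?U. site_dual N \<beta> j e e') / real N"
    unfolding dual_weight_def sum_divide_distrib[symmetric] by (subst sum.swap) (rule refl)
  also have "\<dots> = (\<Sum>j<N. \<Sum>y\<in>?D. update_prob N \<beta> j x 1 * of_bool (y = x(j := 1))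
      + update_prob N \<beta> j x (-1) * of_bool (y = x(j := -1))) / real N"
    using sum_site_dual_above[OF N _ x e] sum_site_update_below[OF _ x e]
    by (intro arg_cong2[where f = divide, OF sum.cong[OF refl] refl]) simp
  also have "\<dots> = (\<Sum>y\<in>?D. gibbs_matrix N \<beta> x y)"
    using N by (subst sum.swap) (simp add: gibbs_matrix_eq of_bool_def flip: sum_divide_distrib)
  finally show ?thesis .
qed

text \<open>A site \<open>j\<close> with \<open>e j = -1\<close> only charges configurations that have \<open>j\<close> raised, and these are
  not below \<open>e\<close>. A site with \<open>e j = 1\<close> charges \<open>e\<close> alone. Hence the dual never moves
  strictly down, and its holding probability counts the \<open>+1\<close> sites.\<close>

lemma dual_weight_below:
  assumes N: "N \<ge> 3" and e: "e \<in> configs N" and le: "config_le N e' e"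
  shows "dual_weight N \<beta> e e' = real (num_plus N e) / real N * of_bool (e' = e)"
proof -
  have "site_dual N \<beta> j e e' = of_bool (e j = 1) * of_bool (e' = e)" if j: "j < N" for j
  proof (cases "e j = 1")
    case False
    then have "e' j \<noteq> 1"
      using configs_spin[OF e j] le j by (auto simp: config_le_def)
    then have "e' \<noteq> e(j := 1)" "e' \<noteq> e(j := 1, cw N j := -1)" "e' \<noteq> e(j := 1, ccw N j := -1)"
      using circle_distinct[OF N j] by auto
    with False show ?thesis by (auto simp: site_dual_def intro!: sum.neutral)
  qed (simp add: site_dual_def)
  then have "dual_weight N \<beta> e e' = (\<Sum>j<N. of_bool (e j = 1)) * of_bool (e' = e) / real N"
    unfolding dual_weight_def sum_distrib_right
    by (intro arg_cong2[where f = divide] sum.cong refl) auto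
  also have "(\<Sum>j<N. of_bool (e j = 1)) = real (num_plus N e)"
    by (simp add: num_plus_def sum.If_cases of_bool_def Int_def)
  finally show ?thesis by simp
qed

text \<open>The other configurations charged by site \<open>j\<close> have a lowered neighbour, and the other sites leave
  \<open>j\<close> at \<open>-1\<close>, so only one term survives.\<close>

lemma dual_weight_above:
  assumes N: "N \<ge> 3" and j: "j < N" and ej: "e j = -1"
  shows "dual_weight N \<beta> e (e(j := 1)) = (1 - up_prob N \<beta> j e) / real N"
proof -
  have "site_dual N \<beta> k e (e(j := 1)) = (if k = j then 1 - up_prob N \<beta> j e else 0)" for k
  proof -
    have 1: "e(j := 1) \<noteq> e" using ej by (metis fun_upd_same one_neq_neg_one)
    have 2: "e(j := 1) = e(k := 1) \<longleftrightarrow> k = j" if "e k \<noteq> 1"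
      using that by (metis fun_upd_same fun_upd_other)
    have 3: "e(j := 1) \<noteq> e(k := 1, i := -1)" if "e i = 1" for i
      using ej that by (metis fun_upd_same fun_upd_other one_neq_neg_one)
    have "(\<Sum>i\<in>{cw N k, ccw N k}.
        (if e i = 1 then bias \<beta> else 0) * of_bool (e(j := 1) = e(k := 1, i := -1))) = 0"
      by (rule sum.neutral) (simp add: 3)
    then show ?thesis
      using ej 1 2 unfolding site_dual_def by (cases "e k = 1") auto
  qed
  then show ?thesis
    using j by (simp add: dual_weight_def)
qed

section \<open>The sharp dual\<close>

lemma config_le_all_plus: "e \<in> configs N \<Longrightarrow> config_le N e (all_plus N)"
  using configs_spin by (fastforce simp: config_le_def all_plus_def)

lemma all_plus_le_iff:
  assumes "e \<in> configs N"
  shows "config_le N (all_plus N) e \<longleftrightarrow> e = all_plus N"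
proof
  assume "config_le N (all_plus N) e"
  then have "e i = all_plus N i" if "i < N" for i
    using configs_spin[OF assms that] that by (force simp: config_le_def all_plus_def)
  then show "e = all_plus N"
    by (rule config_eqI[OF assms all_plus_configs])
qed (simp add: config_le_def)

lemma le_all_minus_iff:
  assumes "e \<in> configs N"
  shows "config_le N e (all_minus N) \<longleftrightarrow> e = all_minus N"
proof
  assume "config_le N e (all_minus N)"
  then have "e i = all_minus N i" if "i < N" for i
    using configs_spin[OF assms that] that by (force simp: config_le_def all_minus_def)
  then show "e = all_minus N"
    by (rule config_eqI[OF assms all_minus_configs])
qed (simp add: config_le_def)

theorem theorem3p1:
  fixes N :: nat and \<beta> :: real
    and M :: "'w measure" and X :: "nat \<Rightarrow> 'w \<Rightarrow> config"
  assumes "N \<ge> 3" and "\<beta> \<ge> 0"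
    and "markov_chain M X (configs N) (gibbs_matrix N \<beta>) (point_mass (all_minus N))"
  shows "\<exists>(M' :: (nat \<Rightarrow> config) measure) (X' :: nat \<Rightarrow> (nat \<Rightarrow> config) \<Rightarrow> config)
          (P' :: config \<Rightarrow> config \<Rightarrow> real).
      sharp_strong_stationary_dual
        M X (configs N) (gibbs_matrix N \<beta>) (point_mass (all_minus N)) (ising_dist N \<beta>)
        M' X' (configs N) P' (point_mass (all_minus N)) (all_plus N) \<and>
      (\<forall>e\<in>configs N. \<forall>e'\<in>configs N.
        (config_less N e' e \<longrightarrow> P' e e' = 0) \<and>
        (e = e' \<longrightarrow> P' e e' = 1 / real N * real (num_plus N e)) \<and>
        (\<forall>j<N. e j = -1 \<and> e' = e(j := e j + 2) \<longrightarrow>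
          P' e e' = down_mass N \<beta> e' / down_mass N \<beta> e * (1 / real N) * (1 - up_prob N \<beta> j e)))"
proof -
  note N = assms(1)
  define E where "E = configs N"
  define \<pi> where "\<pi> = ising_dist N \<beta>"
  define P where "P = gibbs_matrix N \<beta>"
  define a where "a = all_plus N"
  define b where "b = all_minus N"
  define H where "H = down_mass N \<beta>"
  define \<Lambda> where "\<Lambda> = down_link E (config_le N) \<pi>"
  define P' where "P' = (\<lambda>e e'. H e' / H e * dual_weight N \<beta> e e')"
  have fin: "finite E" by (simp add: E_def finite_configs)
  have aE: "a \<in> E" and bE: "b \<in> E"
    by (simp_all add: E_def a_def b_def all_plus_configs all_minus_configs)
  have pos: "\<pi> e > 0" for e by (simp add: \<pi>_def ising_dist_pos)
  have H_eq: "H = (\<lambda>e. \<Sum>y | y \<in> E \<and> config_le N y e. \<pi> y)"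
    by (simp add: fun_eq_iff H_def down_mass_def E_def \<pi>_def)
  have H_pos: "H e > 0" if "e \<in> E" for e
    unfolding H_eq using that fin pos
    by (intro sum_pos2[of _ e]) (auto simp: config_le_def less_imp_le)
  have P_stoch: "stochastic_kernel E E P"
    unfolding E_def P_def by (rule gibbs_matrix_stochastic[OF N])
  have \<Lambda>_stoch: "stochastic_kernel E E \<Lambda>"
    unfolding \<Lambda>_def by (rule down_link_stochastic) (auto simp: fin pos config_le_def)
  have inter: "mat_prod E \<Lambda> P e x = mat_prod E P' \<Lambda> e x" if "e \<in> E" "x \<in> E" for e x
    unfolding \<Lambda>_def P'_def H_eq
  proof (rule down_link_intertwines[OF fin _ _ that])
    show "\<pi> x * P x y = \<pi> y * P y x" if "x \<in> E" "y \<in> E" for x y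
      using gibbs_reversible[OF N] that by (simp add: E_def P_def \<pi>_def)
    show "(\<Sum>y | y \<in> E \<and> config_le N y e. \<pi> y) \<noteq> 0" if "e \<in> E" for e
      using H_pos[OF that] by (simp add: H_eq)
    show "(\<Sum>e' | e' \<in> E \<and> config_le N x e'. dual_weight N \<beta> e e') =
        (\<Sum>y | y \<in> E \<and> config_le N y e. P x y)"
      using dual_weight_moebius[OF N] that by (simp add: E_def P_def)
  qed
  have P'_nonneg: "P' e e' \<ge> 0" if "e \<in> E" "e' \<in> E" for e e'
    unfolding P'_def using that H_pos[of e] H_pos[of e'] dual_weight_nonneg[OF N assms(2)]
    by (intro mult_nonneg_nonneg divide_nonneg_nonneg) (auto simp: E_def less_imp_le)
  have P'_stoch: "stochastic_kernel E E P'"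
    by (rule intertwined_stochastic[OF fin fin P_stoch \<Lambda>_stoch P'_nonneg inter])
  have init: "point_mass b x = vec_mat E (point_mass b) \<Lambda> x" if "x \<in> E" for x
  proof -
    have "vec_mat E (point_mass b) \<Lambda> x = \<Lambda> b x"
      using fin bE by (simp add: vec_mat_def point_mass_def if_distrib[of "\<lambda>c. c * _"] cong: if_cong)
    moreover have "{y \<in> E. config_le N y b} = {b}"
      using bE by (auto simp: E_def b_def le_all_minus_iff)
    ultimately show ?thesis
      using that pos[of b] by (auto simp: \<Lambda>_def down_link_def point_mass_def E_def b_def le_all_minus_iff)
  qed
  have \<Lambda>_top: "\<Lambda> a x = \<pi> x" if "x \<in> E" for x
  proof -
    have "{y \<in> E. config_le N y a} = E"
      by (auto simp: E_def a_def config_le_all_plus)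
    moreover have "(\<Sum>y\<in>E. \<pi> y) = 1"
      using ising_dist_distribution[of N \<beta>] by (simp add: distribution_on_def E_def \<pi>_def)
    ultimately show ?thesis
      using that by (simp add: \<Lambda>_def down_link_def E_def a_def config_le_all_plus)
  qed
  have \<Lambda>_extreme: "\<Lambda> y a = 0" if "y \<in> E" "y \<noteq> a" for y
    using that by (simp add: \<Lambda>_def down_link_def E_def a_def all_plus_le_iff)
  have P'_diag: "P' e e = 1 / real N * real (num_plus N e)" if "e \<in> E" for e
    using dual_weight_below[OF N, of e e \<beta>] that H_pos[OF that]
    by (simp add: P'_def E_def config_le_def)
  have "num_plus N a = N"
    by (simp add: num_plus_def a_def all_plus_def cong: conj_cong)
  then have absorbing: "P' a a = 1"
    using P'_diag[OF aE] N by simp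
  obtain M' :: "(nat \<Rightarrow> config) measure"
    where M': "markov_chain M' (\<lambda>n \<omega>. \<omega> n) E P' (point_mass b)"
    using markov_chain_exists[OF fin P'_stoch bE] by blast
  have "strong_stationary_dual M X E P (point_mass b) \<pi> M' (\<lambda>n \<omega>. \<omega> n) E P' (point_mass b) a"
    unfolding strong_stationary_dual_def
    using assms(3) gibbs_ergodic[OF N, of \<beta>] gibbs_stationary[OF N, of \<beta>] M' aE absorbing
      \<Lambda>_stoch \<Lambda>_top init inter
    by (auto simp: E_def P_def \<pi>_def b_def)
  moreover have "separation E (vec_mat E (point_mass b) (mat_pow E P n)) \<pi> =
      measure M' {\<omega> \<in> space M'. absorption_time (\<lambda>n \<omega>. \<omega> n) a \<omega> > enat n}" for n
    unfolding markov_chain.absorption_time_tail[where P = P' and a = a, OF M' aE absorbing]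
    using fin \<Lambda>_stoch P'_stoch markov_chain.initial[OF M'] pos aE \<Lambda>_top init inter \<Lambda>_extreme
    by (intro separation_eq_unabsorbed_mass[where \<Lambda> = \<Lambda> and m = a])
  ultimately have sharp: "sharp_strong_stationary_dual M X E P (point_mass b) \<pi>
      M' (\<lambda>n \<omega>. \<omega> n) E P' (point_mass b) a"
    by (simp add: sharp_strong_stationary_dual_def)
  have "config_less N e' e \<longrightarrow> P' e e' = 0" if "e \<in> E" "e' \<in> E" for e e'
    using dual_weight_below[OF N, of e e' \<beta>] that by (auto simp: config_less_def P'_def E_def)
  moreover have "P' e e' = H e' / H e * (1 / real N) * (1 - up_prob N \<beta> j e)"
    if "e \<in> E" "j < N" "e j = -1" "e' = e(j := e j + 2)" for e e' j
    using dual_weight_above[OF N, of j e \<beta>] that by (simp add: P'_def E_def)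
  ultimately show ?thesis
    using sharp P'_diag
    by (intro exI[of _ M'] exI[of _ "\<lambda>n \<omega>. \<omega> n"] exI[of _ P'])
      (auto simp: E_def P_def \<pi>_def a_def b_def H_def)
qed

end
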